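(* Let $\mathcal S=\{\phi_e\}_{e\in E}$ be a finite and irreducible conformal GDMS (graph directed Markov system) in $\mathbb R^n$ which satisfies the strong separation condition. Then $J_{\mathcal S}$ is $v$-directed porous for every $v\in S^{n-1}$.
   Context: A GDMS $\mathcal S=\{V,E,A,t,i,\{X_v\}_{v\in V},\{\phi_e\}_{e\in E}\}$, abbreviated $\{\phi_e\}_{e\in E}$, consists of: a directed multigraph with a countable set of edges $E$ (the alphabet, having at least two elements) and a finite set of vertices $V$; an incidence matrix $A:E\times E\to\{0,1\}$; maps $i,t:E\to V$ with $t(a)=i(b)$ whenever $A_{ab}=1$; non-empty compact metric spaces $X_v$; injective contractions $\phi_e:X_{t(e)}\to X_{i(e)}$, all with Lipschitz constant at most a common $s\in(0,1)$. For every $v\in V$ there are $e,e'\in E$ with $t(e)=v$, $i(e')=v$. The GDMS is finite if $E$ is finite. $E_A^n$ is the set of words $\omega=\omega_1\ldots\omega_n$ with $A_{\omega_k\omega_{k+1}}=1$ for all $k<n$; $E_A^*=\bigcup_{n\ge0}E_A^n$; $E_A^{\mathbb N}$ is the set of infinite admissible words; $\omega|_n=\omega_1\ldots\omega_n$. For $\omega\in E_A^n$, $n\ge1$, $\phi_\omega=\phi_{\omega_1}\circ\cdots\circ\phi_{\omega_n}:X_{t(\omega)}\to X_{i(\omega)}$ with $t(\omega)=t(\omega_n)$, $i(\omega)=i(\omega_1)$. A finite GDMS is irreducible if for all $a,b\in E$ there is $\omega\in E_A^*$ with $a\omega b\in E_A^*$. $\pi(\omega)$ is the unique point of $\bigcap_n\phi_{\omega|_n}(X_{t(\omega_n)})$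 for $\omega\in E_A^{\mathbb N}$, and $J_{\mathcal S}=\pi(E_A^{\mathbb N})$ is the limit set. The GDMS is conformal if (1) each $X_v$ is a compact connected subset of a fixed $\mathbb R^n$ with $X_v=\overline{\operatorname{Int}X_v}$; (2) (open set condition) $\phi_a(\operatorname{Int}X_{t(a)})\cap\phi_b(\operatorname{Int}X_{t(b)})=\emptyset$ for $a\ne b$ in $E$; (3) for each $v$ there is an open connected $W_v\supset X_v$ such that each $\phi_e$ with $t(e)=v$ extends to a $C^1$ conformal diffeomorphism of $W_v$ into $W_{i(e)}$ (conformal: the derivative at each point is a similarity). Standing assumptions: compact sets $S_v$ with $X_v\subset\operatorname{Int}S_v\subset S_v\subset W_v$ are fixed, pairwise disjoint; and bounded distortion holds: there are $\alpha>0$, $K\ge1$ with $\big|\|D\phi_\omega(p)\|/\|D\phi_\omega(q)\|-1\big|\le K|p-q|^\alpha$ and $K^{-1}\le\|D\phi_\omega(p)\|/\|D\phi_\omega(q)\|\le K$ for all $\omega\in E_A^*$, $p,q\in S_{t(\omega)}$. Strong separation condition: $\phi_a(X_{t(a)})\cap\phi_b(X_{t(b)})=\emptyset$ for all $a,b\in E$ with $a\ne b$. Directed porosity: for $v\in S^{n-1}$ let $l_v$ be the line through the origin and $v$. For a bounded $G\subset\mathbb R^n$, $x\in\mathbb R^n$, $r>0$, $\operatorname{por}_v(G,x,r)=\sup\{c\ge0:B(y,cr)\subset B(x,r)\setminus G\text{ for some }y\in x+l_v\}$. $G$ is $v$-directed porous if there are $c\in(0,1)$ and $r_0>0$ with $\operatorname{por}_v(G,x,r)\ge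 c$ for every $x\in G$ and $r\in(0,r_0)$. *)

theory Defs
  imports "HOL-Analysis.Analysis"
begin

section \<open>Graph directed Markov systems\<close>

text \<open>
  The relation \<open>A a b\<close> stands for \<open>A\<^sub>a\<^sub>b = 1\<close>. The spaces \<open>X v\<close> are subsets of one ambient
  metric space, and \<open>\<phi> e\<close> is a total function of which, here, only the restriction to
  \<open>X (t e)\<close> matters.
\<close>

locale gdms =
  fixes V :: "'v set"
    and E :: "'e set"
    and A :: "'e \<Rightarrow> 'e \<Rightarrow> bool"
    and t i :: "'e \<Rightarrow> 'v"
    and X :: "'v \<Rightarrow> 'a::metric_space set"
    and \<phi> :: "'e \<Rightarrow> 'a \<Rightarrow> 'a"
  assumes finite_vertices: "finite V"
    and countable_edges: "countable E"
    and two_edges: "\<exists>a\<in>E. \<exists>b\<in>E. a \<noteq> b"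
    and terminal_vertex: "e \<in> E \<Longrightarrow> t e \<in> V"
    and initial_vertex: "e \<in> E \<Longrightarrow> i e \<in> V"
    and incidence: "\<lbrakk>a \<in> E; b \<in> E; A a b\<rbrakk> \<Longrightarrow> t a = i b"
    and space_nonempty: "v \<in> V \<Longrightarrow> X v \<noteq> {}"
    and space_compact: "v \<in> V \<Longrightarrow> compact (X v)"
    and maps_into: "e \<in> E \<Longrightarrow> \<phi> e ` X (t e) \<subseteq> X (i e)"
    and maps_inj: "e \<in> E \<Longrightarrow> inj_on (\<phi> e) (X (t e))"
    and uniform_contraction: "\<exists>s. 0 < s \<and> s < 1 \<and> (\<forall>e\<in>E. s-lipschitz_on (X (t e)) (\<phi> e))"
    and vertex_used: "v \<in> V \<Longrightarrow> (\<exists>e\<in>E. t e = v) \<and> (\<exists>e'\<in>E. i e' = v)"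
begin

definition words :: "'e list set" where
  "words = {\<omega>. set \<omega> \<subseteq> E \<and> successively A \<omega>}"

text \<open>Infinite words are indexed from \<open>0\<close>: \<open>\<omega> k\<close> is the letter \<open>\<omega>\<^sub>k\<^sub>+\<^sub>1\<close>.\<close>

definition inf_words :: "(nat \<Rightarrow> 'e) set" where
  "inf_words = {\<omega>. (\<forall>k. \<omega> k \<in> E) \<and> (\<forall>k. A (\<omega> k) (\<omega> (Suc k)))}"

definition initial_word :: "nat \<Rightarrow> (nat \<Rightarrow> 'e) \<Rightarrow> 'e list" where
  "initial_word n \<omega> = map \<omega> [0..<n]"

definition word_map :: "'e list \<Rightarrow> 'a \<Rightarrow> 'a" where
  "word_map \<omega> = foldr (\<lambda>e f. \<phi> e \<circ> f) \<omega> id"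

definition coding_map :: "(nat \<Rightarrow> 'e) \<Rightarrow> 'a" where
  "coding_map \<omega> = (THE x. x \<in> (\<Inter>n\<in>{1..}. word_map (initial_word n \<omega>) ` X (t (\<omega> (n - 1)))))"

definition limit_set :: "'a set" where
  "limit_set = coding_map ` inf_words"

definition irreducible_gdms :: bool where
  "irreducible_gdms \<longleftrightarrow> (\<forall>a\<in>E. \<forall>b\<in>E. \<exists>\<omega>\<in>words. a # \<omega> @ [b] \<in> words)"

definition strong_separation :: bool where
  "strong_separation \<longleftrightarrow>
     (\<forall>a\<in>E. \<forall>b\<in>E. a \<noteq> b \<longrightarrow> \<phi> a ` X (t a) \<inter> \<phi> b ` X (t b) = {})"

end

section \<open>Conformal systems\<close>

definition C1_on :: "'a::real_normed_vector set \<Rightarrow> ('a \<Rightarrow> 'b::real_normed_vector) \<Rightarrow> bool" where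
  "C1_on U f \<longleftrightarrow>
     (\<exists>f' :: 'a \<Rightarrow> 'a \<Rightarrow>\<^sub>L 'b.
        (\<forall>x\<in>U. (f has_derivative blinfun_apply (f' x)) (at x)) \<and> continuous_on U f')"

definition C1_diffeo_into ::
  "'a::real_normed_vector set \<Rightarrow> 'b::real_normed_vector set \<Rightarrow> ('a \<Rightarrow> 'b) \<Rightarrow> bool" where
  "C1_diffeo_into U U' f \<longleftrightarrow>
     f ` U \<subseteq> U' \<and> inj_on f U \<and> open (f ` U) \<and> C1_on U f \<and> C1_on (f ` U) (inv_into U f)"

definition similarity :: "('a::real_normed_vector \<Rightarrow> 'b::real_normed_vector) \<Rightarrow> bool" where
  "similarity L \<longleftrightarrow> (\<exists>c>0. \<forall>x y. dist (L x) (L y) = c * dist x y)"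

definition conformal_on :: "'a::real_normed_vector set \<Rightarrow> ('a \<Rightarrow> 'b::real_normed_vector) \<Rightarrow> bool" where
  "conformal_on U f \<longleftrightarrow> (\<forall>x\<in>U. similarity (frechet_derivative f (at x)))"

text \<open>
  As usual, the extension of \<open>\<phi> e\<close> from \<open>X (t e)\<close> to \<open>W (t e)\<close> is denoted by \<open>\<phi> e\<close> as well;
  values outside \<open>W (t e)\<close> are irrelevant.
\<close>

locale conformal_gdms = gdms V E A t i X \<phi>
  for V :: "'v set"
    and E :: "'e set"
    and A :: "'e \<Rightarrow> 'e \<Rightarrow> bool"
    and t i :: "'e \<Rightarrow> 'v"
    and X :: "'v \<Rightarrow> (real^'n) set"
    and \<phi> :: "'e \<Rightarrow> real^'n \<Rightarrow> real^'n" +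
  fixes W :: "'v \<Rightarrow> (real^'n) set"
  assumes space_connected: "v \<in> V \<Longrightarrow> connected (X v)"
    and space_regular: "v \<in> V \<Longrightarrow> X v = closure (interior (X v))"
    and open_set_condition: "\<lbrakk>a \<in> E; b \<in> E; a \<noteq> b\<rbrakk> \<Longrightarrow>
          \<phi> a ` interior (X (t a)) \<inter> \<phi> b ` interior (X (t b)) = {}"
    and W_open: "v \<in> V \<Longrightarrow> open (W v)"
    and W_connected: "v \<in> V \<Longrightarrow> connected (W v)"
    and space_subset_W: "v \<in> V \<Longrightarrow> X v \<subseteq> W v"
    and maps_diffeo: "e \<in> E \<Longrightarrow> C1_diffeo_into (W (t e)) (W (i e)) (\<phi> e)"
    and maps_conformal: "e \<in> E \<Longrightarrow> conformal_on (W (t e)) (\<phi> e)"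
begin

definition deriv_norm :: "'e list \<Rightarrow> real^'n \<Rightarrow> real" where
  "deriv_norm \<omega> p = onorm (frechet_derivative (word_map \<omega>) (at p))"

end

text \<open>
  The empty word is left out of the distortion bounds, as it has no terminal vertex; its map
  is the identity, for which they are trivial.
\<close>

locale conformal_gdms_bounded_distortion = conformal_gdms V E A t i X \<phi> W
  for V :: "'v set"
    and E :: "'e set"
    and A :: "'e \<Rightarrow> 'e \<Rightarrow> bool"
    and t i :: "'e \<Rightarrow> 'v"
    and X :: "'v \<Rightarrow> (real^'n) set"
    and \<phi> :: "'e \<Rightarrow> real^'n \<Rightarrow> real^'n"
    and W :: "'v \<Rightarrow> (real^'n) set" +
  fixes S :: "'v \<Rightarrow> (real^'n) set"
  assumes S_compact: "v \<in> V \<Longrightarrow> compact (S v)"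
    and space_subset_interior_S: "v \<in> V \<Longrightarrow> X v \<subseteq> interior (S v)"
    and S_subset_W: "v \<in> V \<Longrightarrow> S v \<subseteq> W v"
    and S_disjoint: "disjoint_family_on S V"
    and bounded_distortion:
      "\<exists>\<alpha> K. 0 < \<alpha> \<and> 1 \<le> K \<and>
         (\<forall>\<omega>\<in>words - {[]}. \<forall>p\<in>S (t (last \<omega>)). \<forall>q\<in>S (t (last \<omega>)).
            \<bar>deriv_norm \<omega> p / deriv_norm \<omega> q - 1\<bar> \<le> K * norm (p - q) powr \<alpha> \<and>
            inverse K \<le> deriv_norm \<omega> p / deriv_norm \<omega> q \<and>
            deriv_norm \<omega> p / deriv_norm \<omega> q \<le> K)"

section \<open>Directed porosity\<close>

text \<open>
  With open balls \<open>c = 0\<close> is always admissible, and for \<open>r > 0\<close> and \<open>v \<noteq> 0\<close> admissible \<open>c\<close> are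
  at most \<open>1\<close>, so the supremum below is a genuine one.
\<close>

definition dir_por :: "real^'n \<Rightarrow> (real^'n) set \<Rightarrow> real^'n \<Rightarrow> real \<Rightarrow> real" where
  "dir_por v G x r =
     Sup {c. 0 \<le> c \<and> (\<exists>y \<in> (\<lambda>z. x + z) ` span {v}. ball y (c * r) \<subseteq> ball x r - G)}"

definition directed_porous :: "real^'n \<Rightarrow> (real^'n) set \<Rightarrow> bool" where
  "directed_porous v G \<longleftrightarrow>
     bounded G \<and>
     (\<exists>c r\<^sub>0. 0 < c \<and> c < 1 \<and> 0 < r\<^sub>0 \<and> (\<forall>x\<in>G. \<forall>r. 0 < r \<and> r < r\<^sub>0 \<longrightarrow> c \<le> dir_por v G x r))"

end

theory Submission
  imports Defs
begin

text \<open>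
  By bounded distortion, for points of \<open>X (t (last \<omega>))\<close> at distance at least a fixed \<open>d\<close>, the
  distance of their images under \<open>word_map \<omega>\<close> is at least a fixed multiple of the diameter of
  the cylinder of \<open>\<omega>\<close>. Given a limit point \<open>x\<close> and a small \<open>r\<close>, take the first cylinder around
  \<open>x\<close> of diameter below \<open>r / 2\<close>. Any other limit point is separated from it at an earlier level,
  where cylinders are still large; by strong separation its distance to this cylinder is thus at
  least a fixed multiple of \<open>r\<close>. A segment of length \<open>3/4 * r\<close> issuing from \<open>x\<close> leaves the
  cylinder, so by connectedness it must pass through the gap, where it meets a hole of the limit
  set of size comparable to \<open>r\<close>.
\<close>

section \<open>Linear similarities and maps with expanding derivative\<close>

text \<open>The ratio of a linear similarity is its operator norm, as a unit basis vector shows.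
  Hence \<open>onorm\<close> of a conformal derivative bounds the stretching from below as well as
  from above.\<close>

lemma similarity_norm:
  fixes L :: "'a::euclidean_space \<Rightarrow> 'b::real_normed_vector"
  assumes "bounded_linear L" and "similarity L"
  shows "0 < onorm L" and "norm (L x) = onorm L * norm x"
proof -
  interpret bounded_linear L by fact
  obtain c where "c > 0" and c: "\<And>x y. dist (L x) (L y) = c * dist x y"
    using assms(2) by (auto simp: similarity_def)
  have norm_L: "norm (L x) = c * norm x" for x
    using c[of x 0] by (simp add: zero)
  obtain b :: 'a where "b \<in> Basis"
    using nonempty_Basis by blast
  have "onorm L = c"
  proof (rule antisym)
    show "onorm L \<le> c"
      by (rule onorm_le) (simp add: norm_L)
    show "c \<le> onorm L"
      using onorm[OF assms(1), of b] \<open>b \<in> Basis\<close> by (simp add: norm_L)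
  qed
  then show "0 < onorm L" "norm (L x) = onorm L * norm x"
    using \<open>c > 0\<close> norm_L by auto
qed

text \<open>
  The largest ball around \<open>f p\<close> inside \<open>f ` ball p h\<close> is convex, so the inverse of \<open>f\<close> is
  Lipschitz with constant \<open>1 / a\<close> on it; it touches the image of the sphere and hence has radius
  at least \<open>a * h\<close>.
\<close>

lemma dist_ge_of_expanding_derivative:
  fixes f :: "'a::euclidean_space \<Rightarrow> 'a"
  assumes "0 < h" and "0 < a" and "cball p h \<subseteq> T" and "inj_on f T"
    and der: "\<And>x. x \<in> cball p h \<Longrightarrow> (f has_derivative f' x) (at x)"
    and expand: "\<And>x v. x \<in> cball p h \<Longrightarrow> a * norm v \<le> norm (f' x v)"
    and "q \<in> T"
  shows "a * min h (dist p q) \<le> dist (f p) (f q)"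
proof -
  define g where "g = inv_into (cball p h) f"
  define U where "U = f ` ball p h"
  have inj: "inj_on f (cball p h)"
    using assms(3,4) by (rule inj_on_subset[rotated])
  have gf: "g (f x) = x" if "x \<in> cball p h" for x
    using that inj by (simp add: g_def)
  have cont_f: "continuous_on (cball p h) f"
    using der has_derivative_continuous by (intro continuous_at_imp_continuous_on) blast
  have cont_g: "continuous_on (f ` cball p h) g"
    using cont_f gf by (intro continuous_on_inv) auto
  have "open U"
    unfolding U_def using continuous_on_subset[OF cont_f ball_subset_cball]
      inj_on_subset[OF inj ball_subset_cball] by (intro invariance_of_domain) auto
  have U_sub: "U \<subseteq> f ` cball p h"
    using ball_subset_cball by (auto simp: U_def)
  have compact_image: "compact (f ` cball p h)"
    using cont_f by (intro compact_continuous_image) auto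
  have "f p \<in> U"
    using \<open>0 < h\<close> by (auto simp: U_def)
  have "bounded U"
    using compact_imp_bounded[OF compact_image] U_sub by (rule bounded_subset)
  then have "- U \<noteq> {}"
    using not_bounded_UNIV[where 'a = 'a] by (metis Compl_empty_eq double_compl)
  then obtain b where "b \<in> - U" and b: "\<And>z. z \<in> - U \<Longrightarrow> dist (f p) b \<le> dist (f p) z"
    using distance_attains_inf[OF closed_Compl[OF \<open>open U\<close>], of "f p"] by blast
  define D where "D = dist (f p) b"
  have "0 < D"
    using \<open>b \<in> - U\<close> \<open>f p \<in> U\<close> by (auto simp: D_def)
  have ball_U: "ball (f p) D \<subseteq> U"
  proof
    fix z
    assume "z \<in> ball (f p) D"
    then show "z \<in> U"
      using b[of z] by (cases "z \<in> U") (auto simp: D_def)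
  qed
  \<comment> \<open>The expansion bound makes \<open>f' x\<close> injective, hence invertible in
    finite dimension, with an inverse of norm at most \<open>1 / a\<close>. Since \<open>g\<close>
    is already known to be continuous, the inverse function rule makes this inverse the derivative
    of \<open>g\<close>.\<close>
  have "\<forall>z\<in>U. \<exists>g'. (g has_derivative g') (at z) \<and> onorm g' \<le> 1 / a"
  proof
    fix z
    assume z: "z \<in> U"
    obtain x where x: "x \<in> ball p h" "z = f x"
      using z by (auto simp: U_def)
    then have x': "x \<in> cball p h" and "g z = x"
      using gf by auto
    have lin: "bounded_linear (f' x)"
      using der[OF x'] by (rule has_derivative_bounded_linear)
    have "inj (f' x)"
    proof (subst linear_injective_0)
      show "linear (f' x)"
        using lin by (rule bounded_linear.linear)
      show "\<forall>v. f' x v = 0 \<longrightarrow> v = 0"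
      proof (intro allI impI)
        fix v
        assume "f' x v = 0"
        then have "a * norm v \<le> 0"
          using expand[OF x', of v] by simp
        then show "v = 0"
          using \<open>0 < a\<close> by (simp add: mult_le_0_iff)
      qed
    qed
    then obtain g' where g': "linear g'" "g' \<circ> f' x = id"
      using linear_injective_left_inverse[OF bounded_linear.linear[OF lin]] by blast
    then have "f' x \<circ> g' = id"
      using linear_inverse_left[OF bounded_linear.linear[OF lin]] by simp
    then have "f' x (g' w) = w" for w
      by (rule pointfree_idE)
    then have norm_g': "norm (g' w) \<le> 1 / a * norm w" for w
      using expand[OF x', of "g' w"] \<open>0 < a\<close> by (simp add: field_simps)
    have "isCont g z"
      using continuous_on_subset[OF cont_g U_sub] continuous_on_eq_continuous_at[OF \<open>open U\<close>] z
      by blast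
    moreover have "f (g w) = w" if "w \<in> U" for w
      using that U_sub gf by auto
    moreover have "(f has_derivative f' x) (at (g z))"
      using der[OF x'] \<open>g z = x\<close> by simp
    moreover have "bounded_linear g'"
      using g'(1) by (simp add: linear_linear)
    ultimately have "(g has_derivative g') (at z)"
      using has_derivative_inverse_basic[OF _ _ g'(2) _ \<open>open U\<close> z] by blast
    moreover have "onorm g' \<le> 1 / a"
      using norm_g' by (rule onorm_le)
    ultimately show "\<exists>g'. (g has_derivative g') (at z) \<and> onorm g' \<le> 1 / a"
      by (intro exI conjI)
  qed
  then obtain g' where "\<forall>z\<in>U. (g has_derivative g' z) (at z) \<and> onorm (g' z) \<le> 1 / a"
    unfolding bchoice_iff by (rule exE)
  then have g': "(g has_derivative g' z) (at z)" "onorm (g' z) \<le> 1 / a" if "z \<in> U" for z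
    using that by auto
  have g_lip: "norm (g z - p) \<le> 1 / a * norm (z - f p)" if "z \<in> ball (f p) D" for z
  proof -
    have "norm (g z - g (f p)) \<le> 1 / a * norm (z - f p)"
    proof (rule differentiable_bound)
      show "convex (ball (f p) D)" by simp
      show "(g has_derivative g' w) (at w within ball (f p) D)" if "w \<in> ball (f p) D" for w
        using g'(1)[of w] ball_U that by (blast intro: has_derivative_at_withinI)
      show "onorm (g' w) \<le> 1 / a" if "w \<in> ball (f p) D" for w
        using g'(2)[of w] ball_U that by blast
      show "z \<in> ball (f p) D" by (fact that)
      show "f p \<in> ball (f p) D" using \<open>0 < D\<close> by simp
    qed
    then show ?thesis
      using gf[of p] \<open>0 < h\<close> by simp
  qed
  have cl: "closure (ball (f p) D) \<subseteq> f ` cball p h"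
    using ball_U U_sub compact_image by (intro closure_minimal) (auto simp: compact_imp_closed)
  have b_cl: "b \<in> closure (ball (f p) D)"
    using \<open>0 < D\<close> by (simp add: D_def)
  \<comment> \<open>The nearest point \<open>b\<close> of the complement lies only on the boundary
    of the ball, so the Lipschitz estimate reaches it by continuity.\<close>
  have "norm (g b - p) - 1 / a * norm (b - f p) \<le> 0"
  proof (rule continuous_le_on_closure[where S = "ball (f p) D"
        and f = "\<lambda>z. norm (g z - p) - 1 / a * norm (z - f p)"])
    show "continuous_on (closure (ball (f p) D)) (\<lambda>z. norm (g z - p) - 1 / a * norm (z - f p))"
      using cl by (intro continuous_intros continuous_on_subset[OF cont_g])
    show "b \<in> closure (ball (f p) D)" by (fact b_cl)
    show "norm (g z - p) - 1 / a * norm (z - f p) \<le> 0" if "z \<in> ball (f p) D" for z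
      using g_lip[OF that] by simp
  qed
  moreover have "h \<le> norm (g b - p)"
  proof -
    obtain q' where q': "q' \<in> cball p h" "b = f q'"
      using cl b_cl by auto
    then have "q' \<notin> ball p h"
      using \<open>b \<in> - U\<close> by (auto simp: U_def)
    then show ?thesis
      using q' gf by (simp add: dist_norm norm_minus_commute)
  qed
  ultimately have "h \<le> 1 / a * norm (b - f p)"
    by linarith
  then have "a * h \<le> D"
    using \<open>0 < a\<close> by (simp add: field_simps D_def dist_norm norm_minus_commute)
  show ?thesis
  proof (cases "dist (f p) (f q) < a * h")
    case True
    then have fq: "f q \<in> ball (f p) D"
      using \<open>a * h \<le> D\<close> by simp
    then obtain q' where q': "q' \<in> ball p h" "f q = f q'"
      using ball_U by (auto simp: U_def)
    then have "q' \<in> cball p h"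
      using ball_subset_cball by blast
    \<comment> \<open>Injectivity on all of \<open>T\<close> is what counts here: \<open>q\<close>
      itself might have been far from \<open>p\<close>, but it has the same image as
      \<open>q'\<close> and so equals it.\<close>
    then have "q \<in> cball p h"
      using assms(3,7) inj_onD[OF assms(4) q'(2)] by blast
    then have "a * dist p q \<le> dist (f p) (f q)"
      using g_lip[OF fq] gf \<open>0 < a\<close> by (simp add: field_simps dist_norm norm_minus_commute)
    moreover have "a * min h (dist p q) \<le> a * dist p q"
      using \<open>0 < a\<close> by (intro mult_left_mono) auto
    ultimately show ?thesis
      by simp
  next
    case False
    moreover have "a * min h (dist p q) \<le> a * h"
      using \<open>0 < a\<close> by (intro mult_left_mono) auto
    ultimately show ?thesis
      by simp
  qed
qed

section \<open>Chains of short steps in compact connected sets\<close>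

text \<open>Any two points are joined by a chain of steps shorter than \<open>h\<close>, and
  compactness bounds the number of steps. The set need not be convex, so a derivative bound can be
  used only on small balls, and the chain adds up these local bounds. The number \<open>N\<close> is
  chosen before \<open>f\<close> and \<open>\<beta>\<close>, so that one \<open>N\<close> serves all
  word maps.\<close>

lemma compact_connected_chain_bound:
  fixes X :: "'a::metric_space set"
  assumes "compact X" and "connected X" and "0 < h"
  obtains N :: nat where
    "\<And>(f :: 'a \<Rightarrow> 'b::metric_space) \<beta> p q.
       \<lbrakk>\<And>p q. \<lbrakk>p \<in> X; q \<in> X; dist p q < h\<rbrakk> \<Longrightarrow> dist (f p) (f q) \<le> \<beta>; p \<in> X; q \<in> X\<rbrakk>
       \<Longrightarrow> dist (f p) (f q) \<le> real N * \<beta>"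
proof -
  define small :: "('a \<Rightarrow> 'b) \<Rightarrow> real \<Rightarrow> bool" where
    "small f \<beta> \<longleftrightarrow> (\<forall>p\<in>X. \<forall>q\<in>X. dist p q < h \<longrightarrow> dist (f p) (f q) \<le> \<beta>)" for f \<beta>
  \<comment> \<open>Being joined by finitely many steps is an equivalence relation with relatively
    open classes, so connectedness leaves one class. Quantifying over \<open>f\<close> and
    \<open>\<beta>\<close> inside makes \<open>n\<close> depend on the two points only.\<close>
  have "\<exists>n::nat. \<forall>f \<beta>. small f \<beta> \<longrightarrow> dist (f p) (f q) \<le> real n * \<beta>" if "p \<in> X" "q \<in> X" for p q
  proof (rule connected_equivalence_relation[OF assms(2) that])
    fix p q
    assume "\<exists>n::nat. \<forall>f \<beta>. small f \<beta> \<longrightarrow> dist (f p) (f q) \<le> real n * \<beta>"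
    then show "\<exists>n::nat. \<forall>f \<beta>. small f \<beta> \<longrightarrow> dist (f q) (f p) \<le> real n * \<beta>"
      by (simp add: dist_commute)
  next
    fix p q r
    assume "\<exists>n::nat. \<forall>f \<beta>. small f \<beta> \<longrightarrow> dist (f p) (f q) \<le> real n * \<beta>"
      and "\<exists>n::nat. \<forall>f \<beta>. small f \<beta> \<longrightarrow> dist (f q) (f r) \<le> real n * \<beta>"
    then obtain m n :: nat where
      mn: "\<forall>f \<beta>. small f \<beta> \<longrightarrow> dist (f p) (f q) \<le> real m * \<beta>"
        "\<forall>f \<beta>. small f \<beta> \<longrightarrow> dist (f q) (f r) \<le> real n * \<beta>"
      by blast
    have "dist (f p) (f r) \<le> real (m + n) * \<beta>" if "small f \<beta>" for f \<beta>
    proof -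
      have "dist (f p) (f r) \<le> dist (f p) (f q) + dist (f q) (f r)"
        by (rule dist_triangle)
      then show ?thesis
        using mn(1)[rule_format, OF that] mn(2)[rule_format, OF that] by (simp add: algebra_simps)
    qed
    then show "\<exists>n::nat. \<forall>f \<beta>. small f \<beta> \<longrightarrow> dist (f p) (f r) \<le> real n * \<beta>"
      by (intro exI[of _ "m + n"]) simp
  next
    fix p
    assume "p \<in> X"
    then show "\<exists>T. openin (top_of_set X) T \<and> p \<in> T \<and>
        (\<forall>q\<in>T. \<exists>n::nat. \<forall>f \<beta>. small f \<beta> \<longrightarrow> dist (f p) (f q) \<le> real n * \<beta>)"
      using \<open>0 < h\<close> by (intro exI[of _ "X \<inter> ball p h"] conjI ballI exI[of _ 1])
        (auto simp: small_def intro: openin_open_Int)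
  qed
  then have "\<forall>p q. \<exists>n::nat. p \<in> X \<longrightarrow> q \<in> X \<longrightarrow> (\<forall>f \<beta>. small f \<beta> \<longrightarrow> dist (f p) (f q) \<le> real n * \<beta>)"
    by blast
  then obtain n :: "'a \<Rightarrow> 'a \<Rightarrow> nat" where "\<forall>p q. p \<in> X \<longrightarrow> q \<in> X \<longrightarrow>
      (\<forall>f \<beta>. small f \<beta> \<longrightarrow> dist (f p) (f q) \<le> real (n p q) * \<beta>)"
    unfolding choice_iff by blast
  then have n: "dist (f p) (f q) \<le> real (n p q) * \<beta>"
    if "p \<in> X" "q \<in> X" "small f \<beta>" for p q f \<beta>
    using that by blast
  obtain F where F: "finite F" "F \<subseteq> X" "X \<subseteq> (\<Union>p\<in>F. ball p h)"
    using compactE_image[OF assms(1), of X "\<lambda>p. ball p h"] \<open>0 < h\<close> by force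
  \<comment> \<open>The element 0 covers the case of an empty net \<open>F\<close>.\<close>
  define M where "M = Max (insert 0 ((\<lambda>(p, q). n p q) ` (F \<times> F)))"
  have M: "n p q \<le> M" if "p \<in> F" "q \<in> F" for p q
    unfolding M_def using F(1) that by (intro Max_ge) auto
  \<comment> \<open>The two extra steps lead from \<open>p\<close> and \<open>q\<close> to nearby
    points of the net.\<close>
  have "dist (f p) (f q) \<le> real (M + 2) * \<beta>" if pq: "small f \<beta>" "p \<in> X" "q \<in> X" for f \<beta> p q
  proof -
    have "\<exists>p'\<in>F. dist p' x < h" if "x \<in> X" for x
      using subsetD[OF F(3) that] by simp
    then obtain p' q' where p': "p' \<in> F" "dist p' p < h" and q': "q' \<in> F" "dist q' q < h"
      using pq by metis
    have "0 \<le> \<beta>"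
      using pq \<open>0 < h\<close> unfolding small_def by (metis dist_self)
    have "dist (f p') (f p) \<le> \<beta>" "dist (f q') (f q) \<le> \<beta>"
      using pq p' q' F(2) unfolding small_def by blast+
    moreover have "dist (f p') (f q') \<le> real M * \<beta>"
    proof -
      have "dist (f p') (f q') \<le> real (n p' q') * \<beta>"
        using p' q' F(2) pq by (intro n) auto
      also have "\<dots> \<le> real M * \<beta>"
        using M[of p' q'] p' q' \<open>0 \<le> \<beta>\<close> by (intro mult_right_mono) auto
      finally show ?thesis .
    qed
    moreover have "dist (f p) (f q) \<le> dist (f p') (f p) + dist (f p') (f q') + dist (f q') (f q)"
      by metric
    ultimately show ?thesis
      by (simp add: algebra_simps)
  qed
  then show thesis
    by (intro that[of "M + 2"]) (auto simp: small_def)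
qed

section \<open>Holes along lines and lower bounds for directed porosity\<close>

text \<open>By the gap, the open \<open>c * r\<close>-neighbourhoods of \<open>P\<close> and of
  \<open>J - P\<close> are disjoint. A segment from \<open>x\<close> that is too long for the first
  neighbourhood cannot be covered by the two, and any uncovered point is the centre of a
  hole.\<close>

lemma ball_on_line_avoiding:
  fixes v x :: "'a::real_normed_vector"
  assumes "norm v = 1" and "0 < r" and "0 < c" and "c < 1/4"
    and "x \<in> P" and "P \<subseteq> J"
    and near: "\<And>z. z \<in> P \<Longrightarrow> dist x z \<le> r / 2"
    and gap: "\<And>z z'. \<lbrakk>z \<in> P; z' \<in> J - P\<rbrakk> \<Longrightarrow> 2 * c * r \<le> dist z z'"
  obtains y where "y \<in> (\<lambda>z. x + z) ` span {v}" and "ball y (c * r) \<subseteq> ball x r - J"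
proof -
  \<comment> \<open>The length \<open>3/4 * r\<close> meets two demands: it exceeds
    \<open>r / 2 + c * r\<close>, so the far end escapes the neighbourhood of \<open>P\<close>, and
    adding \<open>c * r\<close> to it does not exceed \<open>r\<close>, so the hole stays inside
    \<open>ball x r\<close>.\<close>
  define L where "L = (\<lambda>s. x + s *\<^sub>R v) ` {0..3/4 * r}"
  define U where "U Q = (\<Union>z\<in>Q. ball z (c * r))" for Q :: "'a set"
  have "connected L"
    unfolding L_def by (intro connected_continuous_image continuous_intros connected_Icc)
  have "\<not> L \<subseteq> U P \<union> U (J - P)"
  proof
    assume cover: "L \<subseteq> U P \<union> U (J - P)"
    have disj: "U P \<inter> U (J - P) = {}"
    proof (rule ccontr)
      assume "U P \<inter> U (J - P) \<noteq> {}"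
      then obtain y where "y \<in> U P" "y \<in> U (J - P)"
        by blast
      then obtain z z' where "z \<in> P" "z' \<in> J - P" "dist z y < c * r" "dist z' y < c * r"
        unfolding U_def by (meson UN_E mem_ball)
      moreover have "dist z z' \<le> dist z y + dist z' y"
        by metric
      ultimately show False
        using gap[of z z'] by auto
    qed
    have "x \<in> L"
      unfolding L_def using \<open>0 < r\<close> by (intro image_eqI[of _ _ 0]) auto
    moreover have "x \<in> U P"
      using \<open>x \<in> P\<close> \<open>0 < c\<close> \<open>0 < r\<close> by (auto simp: U_def intro: bexI[of _ x])
    moreover have "open (U Q)" for Q
      by (auto simp: U_def)
    \<comment> \<open>The segment meets \<open>U P\<close> at its starting point \<open>x\<close>,
      so connectedness puts all of it into \<open>U P\<close>, including the far end.\<close>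
    ultimately have "U (J - P) \<inter> L = {}"
      using connectedD[OF \<open>connected L\<close>, of "U P" "U (J - P)"] disj cover
      by blast
    moreover have e: "x + (3/4 * r) *\<^sub>R v \<in> L"
      unfolding L_def using \<open>0 < r\<close> by (intro image_eqI[of _ _ "3/4 * r"]) auto
    ultimately have "x + (3/4 * r) *\<^sub>R v \<in> U P"
      using cover by blast
    then obtain z where z: "z \<in> P" "dist z (x + (3/4 * r) *\<^sub>R v) < c * r"
      by (auto simp: U_def)
    have "3/4 * r = dist x (x + (3/4 * r) *\<^sub>R v)"
      using \<open>norm v = 1\<close> \<open>0 < r\<close> by (simp add: dist_norm)
    also have "\<dots> \<le> dist x z + dist z (x + (3/4 * r) *\<^sub>R v)"
      by (rule dist_triangle)
    also have "\<dots> < r / 2 + c * r"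
      using near[OF z(1)] z(2) by simp
    also have "\<dots> \<le> r / 2 + 1/4 * r"
      using \<open>c < 1/4\<close> \<open>0 < r\<close> by (simp add: mult_right_mono)
    finally show False by simp
  qed
  then obtain w where "w \<in> L" "w \<notin> U P \<union> U (J - P)"
    by blast
  then obtain s where s: "0 \<le> s" "s \<le> 3/4 * r" "x + s *\<^sub>R v \<notin> U P \<union> U (J - P)"
    unfolding L_def by force
  define y where "y = x + s *\<^sub>R v"
  have "dist x y = s"
    using s \<open>norm v = 1\<close> by (simp add: y_def dist_norm)
  have "c * r \<le> 1/4 * r"
    using \<open>c < 1/4\<close> \<open>0 < r\<close> by (simp add: mult_right_mono)
  show thesis
  proof
    show "y \<in> (\<lambda>z. x + z) ` span {v}"
      by (auto simp: y_def span_base span_scale)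
    show "ball y (c * r) \<subseteq> ball x r - J"
    proof
      fix z
      assume z: "z \<in> ball y (c * r)"
      have "dist x z \<le> dist x y + dist y z"
        by (rule dist_triangle)
      then have "dist x z < r"
        using z \<open>dist x y = s\<close> s(2) \<open>c * r \<le> 1/4 * r\<close> by simp
      moreover have "z \<notin> J"
      proof
        assume "z \<in> J"
        moreover have "y \<in> ball z (c * r)"
          using z by (simp add: dist_commute)
        ultimately have "y \<in> U P \<union> U (J - P)"
          unfolding U_def by blast
        then show False
          using s(3) by (simp add: y_def)
      qed
      ultimately show "z \<in> ball x r - J"
        by simp
    qed
  qed
qed

text \<open>A witness bounds the supremum from below once the admissible constants are bounded
  above: one ball inside another forces them to be at most 1.\<close>

lemma dir_por_ge:
  assumes "0 \<le> c" and "0 < r" and "y \<in> (\<lambda>z. x + z) ` span {v}" and "ball y (c * r) \<subseteq> ball x r - G"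
  shows "c \<le> dir_por v G x r"
  unfolding dir_por_def
proof (rule cSup_upper)
  let ?C = "{c. 0 \<le> c \<and> (\<exists>y \<in> (\<lambda>z. x + z) ` span {v}. ball y (c * r) \<subseteq> ball x r - G)}"
  show "c \<in> ?C"
    using assms by blast
  have "c \<le> 1" if c: "c \<in> ?C" for c
  proof (rule ccontr)
    assume "\<not> c \<le> 1"
    obtain y where "ball y (c * r) \<subseteq> ball x r - G"
      using c by blast
    then have y: "ball y (c * r) \<subseteq> ball x r"
      by blast
    have "0 < c * r"
      using \<open>\<not> c \<le> 1\<close> \<open>0 < r\<close> by simp
    then have "dist y x + c * r \<le> r"
      using y unfolding ball_subset_ball_iff by linarith
    then have "c * r \<le> r"
      using zero_le_dist[of y x] by linarith
    then show False
      using \<open>\<not> c \<le> 1\<close> \<open>0 < r\<close> by simp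
  qed
  then show "bdd_above ?C"
    by (rule bdd_aboveI)
qed

text \<open>A minimum of finitely many positive constants works for all indices, as the conditions
  are inherited by smaller constants. It is applied to pairs of edges and to vertices.\<close>

lemma uniform_positive_lower_bound:
  fixes P :: "'a \<Rightarrow> real \<Rightarrow> bool"
  assumes "finite I" and "\<And>j. j \<in> I \<Longrightarrow> \<exists>c>0. P j c"
    and mono: "\<And>j c c'. \<lbrakk>P j c; 0 < c'; c' \<le> c\<rbrakk> \<Longrightarrow> P j c'"
  obtains c where "0 < c" and "\<And>j. j \<in> I \<Longrightarrow> P j c"
proof -
  obtain c where c: "\<And>j. j \<in> I \<Longrightarrow> 0 < c j \<and> P j (c j)"
    using assms(2) by metis
  have "0 < Min (insert 1 (c ` I))"
    using assms(1) c by auto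
  moreover have "P j (Min (insert 1 (c ` I)))" if "j \<in> I" for j
    using mono[of j "c j"] c[OF that] calculation assms(1) that by auto
  ultimately show thesis
    by (rule that)
qed

section \<open>Words, cylinders and the coding map\<close>

context gdms
begin

lemma Nil_words: "[] \<in> words"
  by (simp add: words_def)

lemma Cons_words: "a # \<omega> \<in> words \<longleftrightarrow> a \<in> E \<and> \<omega> \<in> words \<and> (\<omega> = [] \<or> A a (hd \<omega>))"
  by (auto simp: words_def successively_Cons)

lemma words_ConsD:
  assumes "a # \<omega> \<in> words"
  shows "a \<in> E" and "\<omega> \<in> words" and "\<omega> \<noteq> [] \<Longrightarrow> t a = i (hd \<omega>)"
proof -
  show "a \<in> E" "\<omega> \<in> words"
    using assms by (simp_all add: Cons_words)
  assume "\<omega> \<noteq> []"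
  then have "hd \<omega> \<in> E" "A a (hd \<omega>)"
    using assms hd_in_set[of \<omega>] by (auto simp: words_def successively_Cons)
  then show "t a = i (hd \<omega>)"
    using incidence \<open>a \<in> E\<close> by simp
qed

lemma word_map_Nil [simp]: "word_map [] = id"
  by (simp add: word_map_def)

lemma word_map_Cons [simp]: "word_map (a # \<omega>) = \<phi> a \<circ> word_map \<omega>"
  by (simp add: word_map_def)

lemma word_map_append: "word_map (\<omega> @ \<tau>) = word_map \<omega> \<circ> word_map \<tau>"
  by (induction \<omega>) auto

text \<open>Stated for any family \<open>Y\<close>, since it is needed for the spaces \<open>X\<close> and for the domains \<open>W\<close>.\<close>

lemma word_map_into:
  assumes "\<omega> \<in> words" and "\<omega> \<noteq> []"
    and "\<And>e. e \<in> E \<Longrightarrow> \<phi> e ` Y (t e) \<subseteq> Y (i e)"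
  shows "word_map \<omega> ` Y (t (last \<omega>)) \<subseteq> Y (i (hd \<omega>))"
  using assms(1,2)
proof (induction \<omega>)
  case (Cons a \<omega>)
  show ?case
  proof (cases "\<omega> = []")
    case False
    then have "word_map \<omega> ` Y (t (last \<omega>)) \<subseteq> Y (t a)"
      using Cons.IH words_ConsD[OF Cons.prems(1)] by simp
    then show ?thesis
      using False Cons.prems assms(3)[of a] by (fastforce simp: Cons_words)
  qed (use Cons.prems assms(3) in \<open>auto simp: Cons_words\<close>)
qed simp

lemmas word_map_space = word_map_into[where Y = X, OF _ _ maps_into]

lemma word_map_lipschitz:
  assumes "0 \<le> s" and "\<And>e. e \<in> E \<Longrightarrow> s-lipschitz_on (X (t e)) (\<phi> e)"
    and "\<omega> \<in> words" and "\<omega> \<noteq> []"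
  shows "(s ^ length \<omega>)-lipschitz_on (X (t (last \<omega>))) (word_map \<omega>)"
  using assms(3,4)
proof (induction \<omega>)
  case (Cons a \<omega>)
  show ?case
  proof (cases "\<omega> = []")
    case False
    then have "word_map \<omega> ` X (t (last \<omega>)) \<subseteq> X (t a)"
      using word_map_space[of \<omega>] words_ConsD[OF Cons.prems(1)] by simp
    moreover have "s-lipschitz_on (X (t a)) (\<phi> a)"
      using Cons.prems assms(2) by (simp add: Cons_words)
    ultimately have "s-lipschitz_on (word_map \<omega> ` X (t (last \<omega>))) (\<phi> a)"
      using lipschitz_on_subset by blast
    then have "(s * s ^ length \<omega>)-lipschitz_on (X (t (last \<omega>))) (\<phi> a \<circ> word_map \<omega>)"
      using Cons False by (intro lipschitz_on_compose) (auto simp: Cons_words)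
    then show ?thesis
      using False by simp
  qed (use Cons.prems assms(2) in \<open>auto simp: Cons_words\<close>)
qed simp

lemma length_initial_word [simp]: "length (initial_word n \<omega>) = n"
  by (simp add: initial_word_def)

lemma initial_word_Suc: "initial_word (Suc n) \<omega> = initial_word n \<omega> @ [\<omega> n]"
  by (simp add: initial_word_def)

lemma initial_word_cong:
  "initial_word n \<omega> = initial_word n \<tau> \<longleftrightarrow> (\<forall>k<n. \<omega> k = \<tau> k)"
  by (auto simp: initial_word_def)

lemma last_initial_word [simp]: "0 < n \<Longrightarrow> last (initial_word n \<omega>) = \<omega> (n - 1)"
  by (cases n) (simp_all add: initial_word_Suc)

lemma initial_word_eq_Nil [simp]: "initial_word n \<omega> = [] \<longleftrightarrow> n = 0"
  by (simp add: initial_word_def)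

lemma initial_word_in_words: "\<omega> \<in> inf_words \<Longrightarrow> initial_word n \<omega> \<in> words"
proof (induction n)
  case (Suc n)
  then show ?case
    by (cases n) (auto simp: words_def inf_words_def initial_word_Suc successively_append_iff)
qed (simp add: initial_word_def Nil_words)

text \<open>Meant for \<open>n \<ge> 1\<close> only: for \<open>n = 0\<close> this is the junk set \<open>X (t (\<omega> 0))\<close>.\<close>

abbreviation cylinder :: "(nat \<Rightarrow> 'e) \<Rightarrow> nat \<Rightarrow> 'a set" where
  "cylinder \<omega> n \<equiv> word_map (initial_word n \<omega>) ` X (t (\<omega> (n - 1)))"

text \<open>A word of length \<open>n\<close> contracts by \<open>s ^ n\<close>, and finitely many
  compact spaces have a common bound on their diameters.\<close>

lemma cylinder_diameter_small:
  assumes "\<omega> \<in> inf_words" and "0 < \<epsilon>"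
  shows "\<exists>n\<ge>1. \<forall>x\<in>cylinder \<omega> n. \<forall>y\<in>cylinder \<omega> n. dist x y < \<epsilon>"
proof -
  obtain s where s: "0 < s" "s < 1" "\<And>e. e \<in> E \<Longrightarrow> s-lipschitz_on (X (t e)) (\<phi> e)"
    using uniform_contraction by blast
  have "bounded (\<Union>v\<in>V. X v)"
    using finite_vertices space_compact by (auto intro: compact_imp_bounded)
  then obtain D\<^sub>0 where D\<^sub>0: "\<And>x y. \<lbrakk>x \<in> (\<Union>v\<in>V. X v); y \<in> (\<Union>v\<in>V. X v)\<rbrakk> \<Longrightarrow> dist x y \<le> D\<^sub>0"
    unfolding bounded_two_points by blast
  \<comment> \<open>The maximum with 1 makes \<open>D\<close> positive, as needed for dividing by
    it.\<close>
  define D where "D = max 1 D\<^sub>0"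
  have D: "0 < D" "\<And>x y. \<lbrakk>x \<in> (\<Union>v\<in>V. X v); y \<in> (\<Union>v\<in>V. X v)\<rbrakk> \<Longrightarrow> dist x y \<le> D"
    using D\<^sub>0 by (auto simp: D_def intro: max.coboundedI2)
  obtain n where n: "s ^ n < \<epsilon> / D"
    using real_arch_pow_inv[of "\<epsilon> / D" s] s D(1) \<open>0 < \<epsilon>\<close> by auto
  have "s ^ Suc n * D < \<epsilon>"
  proof -
    have "s ^ Suc n * D \<le> s ^ n * D"
      using s(1,2) D(1) by (intro mult_right_mono) (auto simp: mult_le_cancel_right1)
    also have "\<dots> < \<epsilon>"
      using n D(1) by (simp add: field_simps)
    finally show ?thesis .
  qed
  have lip: "(s ^ Suc n)-lipschitz_on (X (t (\<omega> n))) (word_map (initial_word (Suc n) \<omega>))"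
    using word_map_lipschitz[of s "initial_word (Suc n) \<omega>"] s initial_word_in_words[OF assms(1)]
    by simp
  have "t (\<omega> n) \<in> V"
    using assms(1) terminal_vertex by (simp add: inf_words_def)
  have "dist x y < \<epsilon>" if xy: "x \<in> cylinder \<omega> (Suc n)" "y \<in> cylinder \<omega> (Suc n)" for x y
  proof -
    obtain p q where pq: "p \<in> X (t (\<omega> n))" "q \<in> X (t (\<omega> n))"
      "x = word_map (initial_word (Suc n) \<omega>) p" "y = word_map (initial_word (Suc n) \<omega>) q"
      using xy by auto
    have "dist x y \<le> s ^ Suc n * dist p q"
      using lipschitz_onD[OF lip] pq by blast
    also have "\<dots> \<le> s ^ Suc n * D"
      using D(2)[of p q] pq \<open>t (\<omega> n) \<in> V\<close> s(1) by (intro mult_left_mono) auto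
    finally show ?thesis
      using \<open>s ^ Suc n * D < \<epsilon>\<close> by simp
  qed
  then show ?thesis
    by (intro exI[of _ "Suc n"]) auto
qed

text \<open>Detaching the last letter exposes a first-level image, to which strong separation
  applies. For \<open>n = 0\<close> the remaining prefix is empty and its map is the
  identity.\<close>

lemma cylinder_split:
  "cylinder \<omega> (Suc n) = word_map (initial_word n \<omega>) ` \<phi> (\<omega> n) ` X (t (\<omega> n))"
  by (simp add: initial_word_Suc word_map_append image_comp)

text \<open>Admissibility matches the vertices of consecutive letters. This nests the cylinders, and
  it places the next-level images of different continuations of a word in one common space.\<close>

lemma first_level_subset:
  assumes "\<omega> \<in> inf_words" and "0 < n"
  shows "\<phi> (\<omega> n) ` X (t (\<omega> n)) \<subseteq> X (t (\<omega> (n - 1)))"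
proof -
  have "t (\<omega> (n - 1)) = i (\<omega> n)"
    using assms incidence[of "\<omega> (n - 1)" "\<omega> n"] unfolding inf_words_def
    by (metis (mono_tags, lifting) Suc_pred' mem_Collect_eq)
  then show ?thesis
    using assms maps_into[of "\<omega> n"] by (simp add: inf_words_def)
qed

lemma compact_cylinder:
  assumes "\<omega> \<in> inf_words"
  shows "compact (cylinder \<omega> (Suc n))"
proof (rule compact_continuous_image)
  obtain s where s: "0 < s" "s < 1" "\<And>e. e \<in> E \<Longrightarrow> s-lipschitz_on (X (t e)) (\<phi> e)"
    using uniform_contraction by blast
  have "(s ^ Suc n)-lipschitz_on (X (t (\<omega> n))) (word_map (initial_word (Suc n) \<omega>))"
    using word_map_lipschitz[of s "initial_word (Suc n) \<omega>"] s initial_word_in_words[OF assms]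
    by simp
  then show "continuous_on (X (t (\<omega> (Suc n - 1)))) (word_map (initial_word (Suc n) \<omega>))"
    by (simp add: lipschitz_on_continuous_on)
  show "compact (X (t (\<omega> (Suc n - 1))))"
    using assms terminal_vertex space_compact by (simp add: inf_words_def)
qed

text \<open>Nested non-empty compact sets have a common point, and shrinking diameters make it
  unique, so the definite description in \<open>coding_map\<close> denotes it. Writing the level as
  \<open>Suc n\<close> avoids the junk value at 0.\<close>

lemma coding_map_in_cylinder:
  assumes "\<omega> \<in> inf_words"
  shows "coding_map \<omega> \<in> cylinder \<omega> (Suc n)"
proof -
  define C where "C n = cylinder \<omega> (Suc n)" for n
  have compact: "compact (C n)" for n
    unfolding C_def by (rule compact_cylinder[OF assms])
  have nonempty: "C n \<noteq> {}" for n
    using assms terminal_vertex space_nonempty by (simp add: C_def inf_words_def)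
  have "C (Suc n) \<subseteq> C n" for n
    unfolding C_def cylinder_split[of "Suc n" \<omega>]
    using first_level_subset[OF assms, of "Suc n"] by (intro image_mono) simp
  then have nested: "C n \<subseteq> C m" if "m \<le> n" for m n
    using that by (rule lift_Suc_antimono_le)
  \<comment> \<open>The set \<open>C 0\<close> is the ambient compact set for the finite
    intersection property; a finite intersection contains the deepest set involved.\<close>
  have "C 0 \<inter> (\<Inter>n\<in>UNIV. C n) \<noteq> {}"
  proof (rule compact_imp_fip_image)
    fix I :: "nat set"
    assume "finite I"
    then have "C (Max (insert 0 I)) \<subseteq> C 0 \<inter> (\<Inter>n\<in>I. C n)"
      by (intro Int_greatest INT_greatest nested) auto
    then show "C 0 \<inter> (\<Inter>n\<in>I. C n) \<noteq> {}"
      using nonempty by blast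
  qed (simp_all add: compact compact_imp_closed)
  then obtain x where x: "x \<in> (\<Inter>n. C n)"
    by blast
  have "y = x" if y: "y \<in> (\<Inter>n. C n)" for y
  proof (rule ccontr)
    assume "y \<noteq> x"
    then have "0 < dist y x"
      by simp
    then obtain m where m: "m \<ge> 1" "\<forall>p\<in>cylinder \<omega> m. \<forall>q\<in>cylinder \<omega> m. dist p q < dist y x"
      using cylinder_diameter_small[OF assms] by blast
    have "cylinder \<omega> m = C (m - 1)"
      using m(1) by (simp add: C_def)
    then have "y \<in> cylinder \<omega> m" "x \<in> cylinder \<omega> m"
      using x y by auto
    then show False
      using m(2) by blast
  qed
  with x have "(THE x. x \<in> (\<Inter>n. C n)) \<in> (\<Inter>n. C n)"
    by (rule theI[of "\<lambda>x. x \<in> (\<Inter>n. C n)"])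
  moreover have "(\<Inter>n\<in>{1..}. cylinder \<omega> n) = (\<Inter>n. C n)"
    unfolding C_def atLeast_Suc_greaterThan One_nat_def greaterThan_0 image_image by simp
  ultimately have "coding_map \<omega> \<in> (\<Inter>n. C n)"
    unfolding coding_map_def by simp
  then show ?thesis
    unfolding C_def by blast
qed

lemma bounded_limit_set: "bounded limit_set"
proof (rule bounded_subset)
  show "bounded (\<Union>v\<in>V. X v)"
    using finite_vertices space_compact by (auto intro: compact_imp_bounded)
  show "limit_set \<subseteq> (\<Union>v\<in>V. X v)"
  proof
    fix x
    assume "x \<in> limit_set"
    then obtain \<omega> where \<omega>: "\<omega> \<in> inf_words" "x = coding_map \<omega>"
      by (auto simp: limit_set_def)
    then have "x \<in> \<phi> (\<omega> 0) ` X (t (\<omega> 0))"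
      using coding_map_in_cylinder[of \<omega> 0] by (simp add: initial_word_def)
    then show "x \<in> (\<Union>v\<in>V. X v)"
      using \<omega>(1) maps_into initial_vertex by (fastforce simp: inf_words_def)
  qed
qed

text \<open>Disjoint non-empty compact sets have positive distance, and finiteness of
  \<open>E\<close> leaves finitely many pairs to minimise over.\<close>

lemma first_level_separated:
  assumes "finite E" and "strong_separation"
  obtains d where "0 < d" and "\<And>a b p q. \<lbrakk>a \<in> E; b \<in> E; a \<noteq> b; p \<in> \<phi> a ` X (t a); q \<in> \<phi> b ` X (t b)\<rbrakk>
    \<Longrightarrow> d \<le> dist p q"
proof -
  have compact_image: "compact (\<phi> e ` X (t e))" if "e \<in> E" for e
    using that uniform_contraction terminal_vertex space_compact
    by (intro compact_continuous_image) (auto intro: lipschitz_on_continuous_on)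
  let ?I = "{(a, b). a \<in> E \<and> b \<in> E \<and> a \<noteq> b}"
  let ?P = "\<lambda>(a, b) d. \<forall>p\<in>\<phi> a ` X (t a). \<forall>q\<in>\<phi> b ` X (t b). d \<le> dist p q"
  obtain d where "0 < d" "\<And>j. j \<in> ?I \<Longrightarrow> ?P j d"
  proof (rule uniform_positive_lower_bound[of ?I ?P])
    show "finite ?I"
      by (rule finite_subset[of _ "E \<times> E"]) (use assms(1) in auto)
    show "\<exists>d>0. ?P j d" if jI: "j \<in> ?I" for j
    proof -
      obtain a b where j: "j = (a, b)" "a \<in> E" "b \<in> E" "a \<noteq> b"
        using jI by auto
      let ?A = "\<phi> a ` X (t a)" and ?B = "\<phi> b ` X (t b)"
      have "compact (?A \<times> ?B)"
        using compact_image j(2,3) by (intro compact_Times)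
      moreover have "?A \<times> ?B \<noteq> {}"
        using j terminal_vertex space_nonempty by simp
      moreover have "continuous_on (?A \<times> ?B) (\<lambda>z. dist (fst z) (snd z))"
        by (intro continuous_intros)
      ultimately obtain z where z: "z \<in> ?A \<times> ?B"
        "\<And>w. w \<in> ?A \<times> ?B \<Longrightarrow> dist (fst z) (snd z) \<le> dist (fst w) (snd w)"
        using continuous_attains_inf[of "?A \<times> ?B" "\<lambda>z. dist (fst z) (snd z)"] by blast
      have "?A \<inter> ?B = {}"
        using assms(2) j by (simp add: strong_separation_def)
      then have "0 < dist (fst z) (snd z)"
        using z(1) by (metis IntI empty_iff mem_Times_iff zero_less_dist_iff)
      moreover have "dist (fst z) (snd z) \<le> dist p q" if "p \<in> ?A" "q \<in> ?B" for p q
        using z(2)[of "(p, q)"] that by (simp del: image_iff)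
      ultimately show ?thesis
        unfolding j(1) by blast
    qed
    show "?P j d'" if "?P j d" "0 < d'" "d' \<le> d" for j d d'
      using that by (auto split: prod.splits) (meson order_trans image_eqI)
  qed (use that in blast)
  then show thesis
    using that[of d] by fast
qed

end

section \<open>Conformality of the word maps\<close>

context conformal_gdms
begin

lemma edge_has_derivative:
  assumes "e \<in> E" and "p \<in> W (t e)"
  shows "(\<phi> e has_derivative frechet_derivative (\<phi> e) (at p)) (at p)"
proof -
  have "C1_on (W (t e)) (\<phi> e)"
    using maps_diffeo[OF assms(1)] by (simp add: C1_diffeo_into_def)
  then have "\<phi> e differentiable at p"
    using assms(2) unfolding C1_on_def differentiable_def by blast
  then show ?thesis
    by (simp add: frechet_derivative_works)
qed

lemma word_map_domain:
  assumes "\<omega> \<in> words" and "\<omega> \<noteq> []"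
  shows "word_map \<omega> ` W (t (last \<omega>)) \<subseteq> W (i (hd \<omega>))"
  using assms maps_diffeo by (intro word_map_into) (auto simp: C1_diffeo_into_def)

lemma word_map_Cons_domain:
  assumes "a # \<omega> \<in> words" and "\<omega> \<noteq> []"
  shows "word_map \<omega> ` W (t (last \<omega>)) \<subseteq> W (t a)"
  using word_map_domain[of \<omega>] words_ConsD[OF assms(1)] assms(2) by simp

text \<open>Injectivity is needed on the whole domain \<open>W\<close>, since the lower distance
  estimate compares a point with others outside the ball on which derivatives are
  controlled.\<close>

lemma word_map_inj_on:
  assumes "\<omega> \<in> words" and "\<omega> \<noteq> []"
  shows "inj_on (word_map \<omega>) (W (t (last \<omega>)))"
  using assms
proof (induction \<omega>)
  case (Cons a \<omega>)
  have inj: "inj_on (\<phi> a) (W (t a))"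
    using maps_diffeo words_ConsD(1)[OF Cons.prems(1)] by (simp add: C1_diffeo_into_def)
  show ?case
  proof (cases "\<omega> = []")
    case False
    then have "inj_on (\<phi> a \<circ> word_map \<omega>) (W (t (last \<omega>)))"
      using Cons.IH words_ConsD(2)[OF Cons.prems(1)] word_map_Cons_domain[OF Cons.prems(1)]
      by (intro comp_inj_on inj_on_subset[OF inj]) auto
    then show ?thesis
      unfolding word_map_Cons last_ConsR[OF False] .
  qed (use inj in simp)
qed simp

text \<open>By the chain rule, the derivative is a composition of similarities, whose ratios
  multiply. An existential derivative suits the induction; \<open>frechet_derivative\<close> is
  recovered afterwards by uniqueness.\<close>

lemma word_map_conformal:
  assumes "\<omega> \<in> words" and "\<omega> \<noteq> []" and "p \<in> W (t (last \<omega>))"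
  shows "\<exists>L. (word_map \<omega> has_derivative L) (at p) \<and> similarity L"
  using assms
proof (induction \<omega>)
  case (Cons a \<omega>)
  have edge: "\<exists>L. (\<phi> a has_derivative L) (at q) \<and> similarity L" if "q \<in> W (t a)" for q
    using that edge_has_derivative[of a q] maps_conformal[of a] words_ConsD(1)[OF Cons.prems(1)]
    by (auto simp: conformal_on_def)
  show ?case
  proof (cases "\<omega> = []")
    case False
    then obtain L where L: "(word_map \<omega> has_derivative L) (at p)" "similarity L"
      using Cons.IH Cons.prems words_ConsD(2)[OF Cons.prems(1)] by auto
    have "word_map \<omega> p \<in> W (t a)"
      using word_map_Cons_domain[OF Cons.prems(1) False] Cons.prems(3) False by auto
    then obtain M where M: "(\<phi> a has_derivative M) (at (word_map \<omega> p))" "similarity M"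
      using edge by blast
    obtain c c' where "c > 0" "c' > 0" "\<And>x y. dist (L x) (L y) = c * dist x y"
      "\<And>x y. dist (M x) (M y) = c' * dist x y"
      using L(2) M(2) by (auto simp: similarity_def)
    then have "similarity (M \<circ> L)"
      unfolding similarity_def by (intro exI[of _ "c' * c"]) simp
    moreover have "(\<phi> a \<circ> word_map \<omega> has_derivative M \<circ> L) (at p)"
      using L(1) M(1) by (rule diff_chain_at)
    ultimately show ?thesis
      unfolding word_map_Cons by blast
  qed (use edge Cons.prems in auto)
qed simp

text \<open>Conformality makes \<open>deriv_norm\<close>, the quantity in the distortion bounds, the
  exact stretching factor in every direction.\<close>

lemma word_map_derivative:
  assumes "\<omega> \<in> words" and "\<omega> \<noteq> []" and "p \<in> W (t (last \<omega>))"
  defines "L \<equiv> frechet_derivative (word_map \<omega>) (at p)"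
  shows "(word_map \<omega> has_derivative L) (at p)"
    and "0 < deriv_norm \<omega> p"
    and "norm (L x) = deriv_norm \<omega> p * norm x"
proof -
  obtain M where M: "(word_map \<omega> has_derivative M) (at p)" "similarity M"
    using word_map_conformal[OF assms(1-3)] by blast
  have "L = M"
    using frechet_derivative_at[OF M(1)] by (simp add: L_def)
  then have L: "(word_map \<omega> has_derivative L) (at p)" "similarity L"
    using M by simp_all
  then have "bounded_linear L"
    by (blast intro: has_derivative_bounded_linear)
  then show "(word_map \<omega> has_derivative L) (at p)" "0 < deriv_norm \<omega> p"
      "norm (L x) = deriv_norm \<omega> p * norm x"
    using L similarity_norm[of L] by (simp_all add: deriv_norm_def flip: L_def)
qed

end

section \<open>Bounded distortion and isolated pieces of the limit set\<close>

context conformal_gdms_bounded_distortion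
begin

text \<open>All derivative norms of a word map on \<open>S v\<close> agree up to the factor
  \<open>K\<close> with the one at \<open>p\<close>. Chains of short steps then bound the diameter
  of the image from above, and the expansion estimate bounds the gap from below. The common scale
  cancels, so \<open>c\<close> does not depend on the word.\<close>

lemma word_map_gap_vs_diameter:
  assumes "v \<in> V" and "0 < d"
  shows "\<exists>c>0. \<forall>\<omega>\<in>words - {[]}. t (last \<omega>) = v \<longrightarrow>
    (\<forall>p\<in>X v. \<forall>q\<in>X v. \<forall>p'\<in>X v. \<forall>q'\<in>X v. d \<le> dist p q \<longrightarrow>
      c * dist (word_map \<omega> p') (word_map \<omega> q') \<le> dist (word_map \<omega> p) (word_map \<omega> q))"
proof -
  \<comment> \<open>Balls of radius \<open>h\<close> around points of \<open>X v\<close> stay in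
    \<open>S v\<close>, where the distortion bounds hold.\<close>
  obtain h where "0 < h" and h: "(\<Union>x\<in>X v. cball x h) \<subseteq> interior (S v)"
    using compact_subset_open_imp_cball_epsilon_subset[OF space_compact[OF assms(1)] open_interior
        space_subset_interior_S[OF assms(1)]] by blast
  have cball_S: "cball p h \<subseteq> S v" if "p \<in> X v" for p
    using h interior_subset[of "S v"] that by blast
  obtain K where "1 \<le> K" and K: "\<And>\<omega> p q. \<lbrakk>\<omega> \<in> words - {[]}; p \<in> S (t (last \<omega>)); q \<in> S (t (last \<omega>))\<rbrakk>
      \<Longrightarrow> inverse K \<le> deriv_norm \<omega> p / deriv_norm \<omega> q \<and> deriv_norm \<omega> p / deriv_norm \<omega> q \<le> K"
    using bounded_distortion by blast
  obtain N :: nat where N: "\<And>(f :: real^'n \<Rightarrow> real^'n) \<beta> p q.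
       \<lbrakk>\<And>p q. \<lbrakk>p \<in> X v; q \<in> X v; dist p q < h\<rbrakk> \<Longrightarrow> dist (f p) (f q) \<le> \<beta>; p \<in> X v; q \<in> X v\<rbrakk>
       \<Longrightarrow> dist (f p) (f q) \<le> real N * \<beta>"
    using compact_connected_chain_bound[OF space_compact[OF assms(1)] space_connected[OF assms(1)]
        \<open>0 < h\<close>, where 'b = "real^'n"] by blast
  \<comment> \<open>With \<open>\<rho>\<close> the derivative norm at \<open>p\<close>, this is the
    lower bound \<open>\<rho> / K * min h d\<close> for the gap divided by the upper bound
    \<open>Suc N * (K * \<rho> * h)\<close> for the diameter; \<open>Suc N\<close> in place of
    \<open>N\<close> avoids a zero denominator.\<close>
  define c where "c = min h d / (K * K * h * real (Suc N))"
  have "0 < c"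
    using \<open>0 < h\<close> \<open>0 < d\<close> \<open>1 \<le> K\<close> by (simp add: c_def)
  moreover have "c * dist (word_map \<omega> p') (word_map \<omega> q') \<le> dist (word_map \<omega> p) (word_map \<omega> q)"
    if \<omega>: "\<omega> \<in> words - {[]}" "t (last \<omega>) = v" and "d \<le> dist p q"
      and X: "p \<in> X v" "q \<in> X v" "p' \<in> X v" "q' \<in> X v" for \<omega> p q p' q'
  proof -
    define \<rho> where "\<rho> = deriv_norm \<omega> p"
    let ?L = "\<lambda>x. frechet_derivative (word_map \<omega>) (at x)"
    have words: "\<omega> \<in> words" "\<omega> \<noteq> []"
      using \<omega> by auto
    have S_W: "x \<in> W (t (last \<omega>))" if "x \<in> S v" for x
      using that S_subset_W[OF assms(1)] \<omega>(2) by blast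
    have "p \<in> S v"
      using cball_S[OF X(1)] \<open>0 < h\<close> by auto
    then have "0 < \<rho>"
      using word_map_derivative(2)[OF words] S_W by (simp add: \<rho>_def)
    have der: "(word_map \<omega> has_derivative ?L x) (at x)" if "x \<in> S v" for x
      using word_map_derivative(1)[OF words] S_W that by blast
    have norm_L: "norm (?L x w) = deriv_norm \<omega> x * norm w" if "x \<in> S v" for x w
      using word_map_derivative(3)[OF words] S_W that by blast
    have "inverse K \<le> deriv_norm \<omega> x / \<rho>" "deriv_norm \<omega> x / \<rho> \<le> K" if "x \<in> S v" for x
      using K[OF \<omega>(1), of x p] \<omega>(2) that \<open>p \<in> S v\<close> by (simp_all add: \<rho>_def)
    then have bounds: "\<rho> / K \<le> deriv_norm \<omega> x" "deriv_norm \<omega> x \<le> K * \<rho>" if "x \<in> S v" for x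
      using \<open>0 < \<rho>\<close> \<open>1 \<le> K\<close> that by (auto simp: field_simps)
    \<comment> \<open>The mean value estimate is applied on the convex ball
      \<open>cball x h\<close>, which lies in \<open>S v\<close> but may leave
      \<open>X v\<close>.\<close>
    have local: "dist (word_map \<omega> x) (word_map \<omega> y) \<le> K * \<rho> * h"
      if xy: "x \<in> X v" "y \<in> X v" "dist x y < h" for x y
    proof -
      have "norm (word_map \<omega> x - word_map \<omega> y) \<le> K * \<rho> * norm (x - y)"
      proof (rule differentiable_bound)
        show "convex (cball x h)"
          by simp
        show "(word_map \<omega> has_derivative ?L z) (at z within cball x h)" if "z \<in> cball x h" for z
          using der[of z] cball_S[OF xy(1)] that by (blast intro: has_derivative_at_withinI)
        show "onorm (?L z) \<le> K * \<rho>" if "z \<in> cball x h" for z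
          using bounds(2)[of z] cball_S[OF xy(1)] that by (auto simp: deriv_norm_def)
        show "x \<in> cball x h" "y \<in> cball x h"
          using xy(3) \<open>0 < h\<close> by auto
      qed
      also have "\<dots> \<le> K * \<rho> * h"
        using xy(3) \<open>0 < \<rho>\<close> \<open>1 \<le> K\<close> by (intro mult_left_mono) (auto simp: dist_norm)
      finally show ?thesis
        by (simp add: dist_norm)
    qed
    have "c * dist (word_map \<omega> p') (word_map \<omega> q') \<le> c * (real N * (K * \<rho> * h))"
      using N[OF local X(3,4)] \<open>0 < c\<close> by (intro mult_left_mono) auto
    also have "\<dots> \<le> c * (real (Suc N) * (K * \<rho> * h))"
      using \<open>0 < c\<close> \<open>0 < \<rho>\<close> \<open>1 \<le> K\<close> \<open>0 < h\<close> by (intro mult_left_mono mult_right_mono) auto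
    also have "\<dots> = \<rho> / K * min h d"
      using \<open>1 \<le> K\<close> \<open>0 < h\<close> unfolding c_def by (simp add: field_simps del: of_nat_Suc)
    also have "\<dots> \<le> \<rho> / K * min h (dist p q)"
      using \<open>d \<le> dist p q\<close> \<open>0 < \<rho>\<close> \<open>1 \<le> K\<close> by (intro mult_left_mono) auto
    also have "\<dots> \<le> dist (word_map \<omega> p) (word_map \<omega> q)"
    proof (rule dist_ge_of_expanding_derivative)
      show "cball p h \<subseteq> W v"
        using cball_S[OF X(1)] S_subset_W[OF assms(1)] by blast
      show "inj_on (word_map \<omega>) (W v)"
        using word_map_inj_on[OF words] \<omega>(2) by simp
      show "(word_map \<omega> has_derivative ?L x) (at x)" if "x \<in> cball p h" for x
        using der cball_S[OF X(1)] that by blast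
      show "\<rho> / K * norm w \<le> norm (?L x w)" if "x \<in> cball p h" for x w
      proof -
        have "x \<in> S v"
          using cball_S[OF X(1)] that by blast
        then show ?thesis
          unfolding norm_L[OF \<open>x \<in> S v\<close>] by (intro mult_right_mono bounds) simp_all
      qed
      show "q \<in> W v"
        using space_subset_W[OF assms(1)] X(2) by blast
      show "0 < h" "0 < \<rho> / K"
        using \<open>0 < h\<close> \<open>0 < \<rho>\<close> \<open>1 \<le> K\<close> by simp_all
    qed
    finally show ?thesis .
  qed
  ultimately show ?thesis
    by blast
qed

text \<open>This supplies the pieces required by \<open>ball_on_line_avoiding\<close> at all small
  scales with a single \<open>c\<close>. The separation \<open>d\<close> of first-level images,
  carried to the level where two codes part, yields a gap comparable to \<open>r\<close>.\<close>

lemma limit_set_isolated_pieces: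
  assumes "finite E" and "strong_separation"
  obtains c r\<^sub>0 where "0 < c" and "c < 1/4" and "0 < r\<^sub>0"
    and "\<And>x r. \<lbrakk>x \<in> limit_set; 0 < r; r < r\<^sub>0\<rbrakk> \<Longrightarrow>
      \<exists>P\<subseteq>limit_set. x \<in> P \<and> (\<forall>z\<in>P. dist x z \<le> r / 2) \<and>
        (\<forall>z\<in>P. \<forall>z'\<in>limit_set - P. 2 * c * r \<le> dist z z')"
proof -
  obtain d where "0 < d" and d: "\<And>a b p q. \<lbrakk>a \<in> E; b \<in> E; a \<noteq> b; p \<in> \<phi> a ` X (t a); q \<in> \<phi> b ` X (t b)\<rbrakk>
      \<Longrightarrow> d \<le> dist p q"
    using first_level_separated[OF assms] by blast
  let ?Q = "\<lambda>v c. \<forall>\<omega>\<in>words - {[]}. t (last \<omega>) = v \<longrightarrow>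
    (\<forall>p\<in>X v. \<forall>q\<in>X v. \<forall>p'\<in>X v. \<forall>q'\<in>X v. d \<le> dist p q \<longrightarrow>
      c * dist (word_map \<omega> p') (word_map \<omega> q') \<le> dist (word_map \<omega> p) (word_map \<omega> q))"
  obtain c\<^sub>0 where "0 < c\<^sub>0" and c\<^sub>0: "\<And>v. v \<in> V \<Longrightarrow> ?Q v c\<^sub>0"
  proof (rule uniform_positive_lower_bound[of V ?Q])
    show "finite V"
      by (rule finite_vertices)
    show "\<exists>c>0. ?Q v c" if "v \<in> V" for v
      using word_map_gap_vs_diameter[OF that \<open>0 < d\<close>] .
    show "?Q v c'" if Q: "?Q v c" and c': "0 < c'" "c' \<le> c" for v c c'
    proof (intro ballI impI)
      fix \<omega> p q p' q'
      assume *: "\<omega> \<in> words - {[]}" "t (last \<omega>) = v" "p \<in> X v" "q \<in> X v" "p' \<in> X v" "q' \<in> X v"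
        "d \<le> dist p q"
      have "c' * dist (word_map \<omega> p') (word_map \<omega> q') \<le> c * dist (word_map \<omega> p') (word_map \<omega> q')"
        using c'(2) by (rule mult_right_mono) simp
      also have "\<dots> \<le> dist (word_map \<omega> p) (word_map \<omega> q)"
        using Q * by blast
      finally show "c' * dist (word_map \<omega> p') (word_map \<omega> q') \<le> dist (word_map \<omega> p) (word_map \<omega> q)" .
    qed
  qed (rule that)
  \<comment> \<open>The bound \<open>1/8\<close> ensures \<open>c < 1/4\<close> and
    \<open>2 * c \<le> 1\<close>; the bound \<open>c\<^sub>0 / 4\<close> turns a diameter of at
    least \<open>r / 2\<close> into a gap of at least \<open>2 * c * r\<close>.\<close>
  define c where "c = min (1/8) (c\<^sub>0 / 4)"
  have pieces: "\<exists>P\<subseteq>limit_set. x \<in> P \<and> (\<forall>z\<in>P. dist x z \<le> r / 2) \<and>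
        (\<forall>z\<in>P. \<forall>z'\<in>limit_set - P. 2 * c * r \<le> dist z z')"
    if x: "x \<in> limit_set" and r: "0 < r" "r < d" for x r
  proof -
    obtain \<omega> where \<omega>: "\<omega> \<in> inf_words" "x = coding_map \<omega>"
      using x by (auto simp: limit_set_def)
    \<comment> \<open>The condition \<open>n \<ge> 1\<close> excludes the junk cylinder at level
      0.\<close>
    define small where "small n \<longleftrightarrow> n \<ge> 1 \<and> (\<forall>y\<in>cylinder \<omega> n. \<forall>z\<in>cylinder \<omega> n. dist y z < r / 2)" for n
    define n where "n = (LEAST n. small n)"
    have "\<exists>n. small n"
      using cylinder_diameter_small[OF \<omega>(1), of "r / 2"] r(1) by (simp add: small_def)
    then have "small n"
      unfolding n_def by (rule LeastI_ex)
    have not_small: "\<not> small k" if "k < n" for k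
      using that unfolding n_def by (rule not_less_Least)
    obtain m where m: "n = Suc m"
      using \<open>small n\<close> by (cases n) (auto simp: small_def)
    \<comment> \<open>The piece is defined through codes rather than as the part of the limit set in
      the cylinder, so that every code of a point outside \<open>P\<close> differs from
      \<open>\<omega>\<close> among the first \<open>n\<close> letters.\<close>
    define P where "P = coding_map ` {\<tau> \<in> inf_words. \<forall>k<n. \<tau> k = \<omega> k}"
    have cyl: "z \<in> cylinder \<omega> n" if z: "z \<in> P" for z
    proof -
      obtain \<tau> where \<tau>: "\<tau> \<in> inf_words" "\<forall>k<n. \<tau> k = \<omega> k" "z = coding_map \<tau>"
        using z by (auto simp: P_def)
      then have "initial_word n \<tau> = initial_word n \<omega>" "\<tau> (n - 1) = \<omega> (n - 1)"
        using m by (simp_all add: initial_word_cong)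
      then show ?thesis
        using coding_map_in_cylinder[OF \<tau>(1), of m] \<tau>(3) m by simp
    qed
    have "x \<in> P"
      using \<omega> by (auto simp: P_def)
    moreover have "P \<subseteq> limit_set"
      by (auto simp: P_def limit_set_def)
    moreover have "dist x z \<le> r / 2" if "z \<in> P" for z
      using cyl[OF \<open>x \<in> P\<close>] cyl[OF that] \<open>small n\<close> unfolding small_def by (blast intro: less_imp_le)
    moreover have "2 * c * r \<le> dist z z'" if z: "z \<in> P" and z': "z' \<in> limit_set - P" for z z'
    proof -
      obtain \<tau> where \<tau>: "\<tau> \<in> inf_words" "\<forall>k<n. \<tau> k = \<omega> k" "z = coding_map \<tau>"
        using z by (auto simp: P_def)
      obtain \<tau>' where \<tau>': "\<tau>' \<in> inf_words" "z' = coding_map \<tau>'"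
        using z' by (auto simp: limit_set_def)
      have ex: "\<exists>k. k < n \<and> \<tau>' k \<noteq> \<omega> k"
        using z' \<tau>' by (auto simp: P_def)
      \<comment> \<open>At the first disagreement the two codes still share the prefix
        \<open>u\<close>, so \<open>z\<close> and \<open>z'\<close> are images under
        \<open>word_map u\<close> of points in two different first-level sets.\<close>
      define k where "k = (LEAST k. k < n \<and> \<tau>' k \<noteq> \<omega> k)"
      have k: "k < n" "\<tau>' k \<noteq> \<omega> k"
        using LeastI_ex[OF ex] by (simp_all add: k_def)
      have before: "\<tau>' l = \<omega> l" if "l < k" for l
        using that k(1) not_less_Least[of l "\<lambda>k. k < n \<and> \<tau>' k \<noteq> \<omega> k"] by (auto simp: k_def)
      define u where "u = initial_word k \<omega>"
      have u: "initial_word k \<tau> = u" "initial_word k \<tau>' = u" "\<tau> k = \<omega> k"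
        using \<tau>(2) k(1) before by (auto simp: u_def initial_word_cong)
      have edges: "\<omega> k \<in> E" "\<tau>' k \<in> E"
        using \<omega>(1) \<tau>'(1) by (simp_all add: inf_words_def)
      have "z \<in> word_map u ` \<phi> (\<omega> k) ` X (t (\<omega> k))"
        using coding_map_in_cylinder[OF \<tau>(1), of k] unfolding cylinder_split u \<tau>(3) .
      then obtain p where p: "p \<in> \<phi> (\<omega> k) ` X (t (\<omega> k))" "z = word_map u p"
        by blast
      have "z' \<in> word_map u ` \<phi> (\<tau>' k) ` X (t (\<tau>' k))"
        using coding_map_in_cylinder[OF \<tau>'(1), of k] unfolding cylinder_split u \<tau>'(2) .
      then obtain q where q: "q \<in> \<phi> (\<tau>' k) ` X (t (\<tau>' k))" "z' = word_map u q"
        by blast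
      have "d \<le> dist p q"
        using d[OF edges _ p(1) q(1)] k(2) by simp
      show ?thesis
      proof (cases "k = 0")
        case True
        \<comment> \<open>The empty prefix is outside the scope of the distortion bounds, but here
          the gap \<open>d\<close> itself exceeds \<open>r\<close>; this is why \<open>d\<close>
          serves as the threshold \<open>r\<^sub>0\<close>.\<close>
        then have "dist z z' = dist p q"
          using p(2) q(2) by (simp add: u_def initial_word_def)
        moreover have "2 * c * r \<le> 1 * r"
          using r(1) by (intro mult_right_mono) (simp_all add: c_def)
        ultimately show ?thesis
          using \<open>d \<le> dist p q\<close> r(2) by simp
      next
        case False
        define v where "v = t (\<omega> (k - 1))"
        have "v \<in> V"
          using \<omega>(1) terminal_vertex by (simp add: v_def inf_words_def)
        have "\<tau>' (k - 1) = \<omega> (k - 1)"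
          using before False by simp
        then have pq: "p \<in> X v" "q \<in> X v"
          using first_level_subset[OF \<omega>(1), of k] first_level_subset[OF \<tau>'(1), of k] p(1) q(1) False
          by (auto simp: v_def)
        have u_word: "u \<in> words - {[]}" "t (last u) = v"
          using initial_word_in_words[OF \<omega>(1)] False by (simp_all add: u_def v_def)
        \<comment> \<open>Since \<open>1 \<le> k < n\<close>, minimality of \<open>n\<close> says
          that the cylinder of the common prefix is not yet small.\<close>
        have "\<not> (\<forall>y\<in>cylinder \<omega> k. \<forall>y'\<in>cylinder \<omega> k. dist y y' < r / 2)"
          using not_small[OF k(1)] False unfolding small_def by linarith
        then obtain y y' where "y \<in> cylinder \<omega> k" "y' \<in> cylinder \<omega> k" "r / 2 \<le> dist y y'"
          by (meson not_less)
        then obtain p' q' where pq': "p' \<in> X v" "q' \<in> X v" "r / 2 \<le> dist (word_map u p') (word_map u q')"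
          unfolding u_def v_def by blast
        have "2 * c * r \<le> c\<^sub>0 * (r / 2)"
          using r(1) by (simp add: c_def)
        also have "\<dots> \<le> c\<^sub>0 * dist (word_map u p') (word_map u q')"
          using pq'(3) \<open>0 < c\<^sub>0\<close> by (intro mult_left_mono) auto
        also have "\<dots> \<le> dist (word_map u p) (word_map u q)"
          using c\<^sub>0[OF \<open>v \<in> V\<close>, rule_format, OF u_word pq pq'(1,2) \<open>d \<le> dist p q\<close>] .
        finally show ?thesis
          using p(2) q(2) by simp
      qed
    qed
    ultimately show ?thesis
      by (intro exI[of _ P] conjI ballI)
  qed
  show thesis
  proof (rule that[OF _ _ \<open>0 < d\<close> pieces])
    show "0 < c" "c < 1/4"
      using \<open>0 < c\<^sub>0\<close> by (simp_all add: c_def)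
  qed
qed

end

section \<open>From isolated pieces to directed porosity of the limit set\<close>

theorem theorem3p12:
  fixes V :: "'v set"
    and E :: "'e set"
    and A :: "'e \<Rightarrow> 'e \<Rightarrow> bool"
    and t i :: "'e \<Rightarrow> 'v"
    and X W S :: "'v \<Rightarrow> (real^'n) set"
    and \<phi> :: "'e \<Rightarrow> real^'n \<Rightarrow> real^'n"
  assumes "conformal_gdms_bounded_distortion V E A t i X \<phi> W S"
    and "finite E"
    and "gdms.irreducible_gdms E A"
    and "gdms.strong_separation E t X \<phi>"
  shows "\<forall>v \<in> sphere 0 1. directed_porous v (gdms.limit_set E A t X \<phi>)"
proof
  interpret conformal_gdms_bounded_distortion V E A t i X \<phi> W S
    by fact
  fix v :: "real^'n"
  assume "v \<in> sphere 0 1"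
  then have "norm v = 1"
    by simp
  obtain c r\<^sub>0 where c: "0 < c" "c < 1/4" and "0 < r\<^sub>0"
    and pieces: "\<And>x r. \<lbrakk>x \<in> limit_set; 0 < r; r < r\<^sub>0\<rbrakk> \<Longrightarrow>
      \<exists>P\<subseteq>limit_set. x \<in> P \<and> (\<forall>z\<in>P. dist x z \<le> r / 2) \<and>
        (\<forall>z\<in>P. \<forall>z'\<in>limit_set - P. 2 * c * r \<le> dist z z')"
    using limit_set_isolated_pieces[OF assms(2,4)] by blast
  have "c \<le> dir_por v limit_set x r" if x: "x \<in> limit_set" and r: "0 < r" "r < r\<^sub>0" for x r
  proof -
    obtain P where P: "P \<subseteq> limit_set" "x \<in> P" "\<forall>z\<in>P. dist x z \<le> r / 2"
      "\<forall>z\<in>P. \<forall>z'\<in>limit_set - P. 2 * c * r \<le> dist z z'"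
      using pieces[OF x r] by blast
    obtain y where "y \<in> (\<lambda>z. x + z) ` span {v}" "ball y (c * r) \<subseteq> ball x r - limit_set"
      using ball_on_line_avoiding[OF \<open>norm v = 1\<close> r(1) c P(2,1)] P(3,4) by blast
    then show ?thesis
      using c(1) r(1) by (intro dir_por_ge) auto
  qed
  then show "directed_porous v limit_set"
    unfolding directed_porous_def using bounded_limit_set c \<open>0 < r\<^sub>0\<close>
    by (intro conjI exI[of _ c] exI[of _ r\<^sub>0]) auto
qed

end
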